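(* Let $\Gamma$ be the group associated with a triangle presentation, $\Delta$ the associated triangle building with boundary $\Omega$, and $\Pi\subseteq\Omega$ the set of periodic limit points. Suppose $\omega\in\Omega$ satisfies $g\omega=\omega$ for some $g\in\Gamma\setminus\{e\}$. Then $\omega\in\Pi$.
   Context: **Triangle groups.** Let $(P,L)$ be a finite projective plane of order $q\ge 2$ and $\lambda:P\to L$ a bijection. A triangle presentation is a set $\mathcal{T}\subseteq P^3$ such that: (1) for all $x,y\in P$, $(x,y,z)\in\mathcal T$ for some $z\in P$ if and only if $y$ and $\lambda(x)$ are incident; (2) $(x,y,z)\in\mathcal T\Rightarrow (y,z,x)\in\mathcal T$; (3) for all $x,y\in P$, $(x,y,z)\in\mathcal T$ for at most one $z\in P$. Put $\Gamma=\langle a_x\ (x\in P) : a_xa_ya_z=e \text{ for all }(x,y,z)\in\mathcal T\rangle$, with identity $e$. The Cayley graph of $\Gamma$ (via right multiplication by the $a_x^{\pm1}$) is the one-skeleton of a thick affine building $\Delta=\Delta_{\mathcal T}$ of type $\tilde A_2$ (a triangle building): the vertices are the elements of $\Gamma$, and the chambers (triangles) are the sets $\{g,ga_x^{-1},ga_y\}$ with $(x,y,z)\in\mathcal T$ for some $z$. $\Gamma$ acts simply transitively on the vertices by left multiplication. Edges are oriented as $g\to ga_x$. **Boundary.** An apartment is a subcomplex isomorphic to the Coxeter complex of type $\tilde A_2$ (a Euclidean plane tessellated by equilateral triangles). A sector is one of the six simplicial cones based at a vertex of an apartment. Two sectors are equivalent if they contain a common subsector. $\Omega$ is the set of equivalence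 classes of sectors; a sector in the class $\omega$ is called a representative of $\omega$. $\Gamma$ acts on $\Omega$ by left multiplication of sectors. **Periodic sectors.** For a sector $\mathcal S$ based at $v$, one of its two bounding rays has all edges oriented away from $v$ and the other all edges oriented towards $v$; let $a_{i,j}\in\Gamma$ ($i,j\ge0$) be the vertex reached from $v=a_{0,0}$ by $i$ unit steps parallel to the first and $j$ unit steps parallel to the second. $\mathcal S$ is $(r,s)$-periodic, $(r,s)\in\mathbb Z^2$, if $a_{i,j}^{-1}a_{k,l}=a_{i+r,j+s}^{-1}a_{k+r,l+s}$ whenever all the indices $i,j,k,l,i+r,j+s,k+r,l+s$ are $\geq0$; it is periodic if it is $(r,s)$-periodic for some $(r,s)\ne(0,0)$. A point $\omega\in\Omega$ is a periodic limit point if it has a periodic representative sector (not necessarily containing $e$); $\Pi$ is the set of periodic limit points. *)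

theory Defs
  imports "HOL-Algebra.Group" "HOL-Library.Product_Plus"
begin

section \<open>Projective planes and triangle presentations\<close>

text \<open>The last clause (a quadrangle) is the usual non-degeneracy axiom.\<close>

definition projective_plane :: "'p set \<Rightarrow> 'l set \<Rightarrow> ('p \<Rightarrow> 'l \<Rightarrow> bool) \<Rightarrow> bool" where
  "projective_plane P L inc \<longleftrightarrow>
     (\<forall>x\<in>P. \<forall>y\<in>P. x \<noteq> y \<longrightarrow> (\<exists>!l. l \<in> L \<and> inc x l \<and> inc y l)) \<and>
     (\<forall>l\<in>L. \<forall>m\<in>L. l \<noteq> m \<longrightarrow> (\<exists>!x. x \<in> P \<and> inc x l \<and> inc x m)) \<and>
     (\<exists>Q\<subseteq>P. card Q = 4 \<and> (\<forall>l\<in>L. card {x\<in>Q. inc x l} \<le> 2))"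

definition finite_projective_plane ::
  "nat \<Rightarrow> 'p set \<Rightarrow> 'l set \<Rightarrow> ('p \<Rightarrow> 'l \<Rightarrow> bool) \<Rightarrow> bool" where
  "finite_projective_plane q P L inc \<longleftrightarrow>
     finite P \<and> finite L \<and> projective_plane P L inc \<and>
     (\<forall>l\<in>L. card {x\<in>P. inc x l} = q + 1) \<and>
     (\<forall>x\<in>P. card {l\<in>L. inc x l} = q + 1)"

definition triangle_presentation ::
  "'p set \<Rightarrow> ('p \<Rightarrow> 'l \<Rightarrow> bool) \<Rightarrow> ('p \<Rightarrow> 'l) \<Rightarrow> ('p \<times> 'p \<times> 'p) set \<Rightarrow> bool" where
  "triangle_presentation P inc lam T \<longleftrightarrow>
     T \<subseteq> P \<times> P \<times> P \<and>
     (\<forall>x\<in>P. \<forall>y\<in>P. (\<exists>z\<in>P. (x, y, z) \<in> T) \<longleftrightarrow> inc y (lam x)) \<and>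
     (\<forall>x y z. (x, y, z) \<in> T \<longrightarrow> (y, z, x) \<in> T) \<and>
     (\<forall>x\<in>P. \<forall>y\<in>P. \<forall>z z'. (x, y, z) \<in> T \<longrightarrow> (x, y, z') \<in> T \<longrightarrow> z = z')"


section \<open>Groups given by generators and relations\<close>

text \<open>A word is a list of letters; the letter \<open>(x, True)\<close> stands for the generator \<open>x\<close>
  and \<open>(x, False)\<close> for its formal inverse. The group \<open>\<langle>X | r = e (r \<in> R)\<rangle>\<close> consists of the
  classes of words for the least congruence that makes formal inverses cancel and
  relators trivial.\<close>

type_synonym 'a word = "('a \<times> bool) list"

abbreviation words :: "'a set \<Rightarrow> 'a word set" where
  "words X \<equiv> lists (X \<times> UNIV)"

inductive word_cong :: "'a set \<Rightarrow> 'a word set \<Rightarrow> 'a word \<Rightarrow> 'a word \<Rightarrow> bool"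
  for X R where
  refl: "u \<in> words X \<Longrightarrow> word_cong X R u u"
| sym: "word_cong X R u v \<Longrightarrow> word_cong X R v u"
| trans: "word_cong X R u v \<Longrightarrow> word_cong X R v w \<Longrightarrow> word_cong X R u w"
| append: "word_cong X R u u' \<Longrightarrow> word_cong X R v v' \<Longrightarrow> word_cong X R (u @ v) (u' @ v')"
| cancel: "x \<in> X \<Longrightarrow> word_cong X R [(x, b), (x, \<not> b)] []"
| relator: "r \<in> R \<Longrightarrow> r \<in> words X \<Longrightarrow> word_cong X R r []"

definition word_class :: "'a set \<Rightarrow> 'a word set \<Rightarrow> 'a word \<Rightarrow> 'a word set" where
  "word_class X R u = {v. word_cong X R u v}"

definition presented_group :: "'a set \<Rightarrow> 'a word set \<Rightarrow> 'a word set monoid" where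
  "presented_group X R =
     \<lparr>carrier = word_class X R ` words X,
      mult = (\<lambda>A B. \<Union>u\<in>A. \<Union>v\<in>B. word_class X R (u @ v)),
      one = word_class X R []\<rparr>"

lemma word_cong_words:
  "word_cong X R u v \<Longrightarrow> u \<in> words X \<and> v \<in> words X"
  by (induction rule: word_cong.induct) auto

lemma word_class_eq_iff:
  assumes "u \<in> words X"
  shows "word_class X R u = word_class X R v \<longleftrightarrow> word_cong X R u v"
proof
  assume "word_class X R u = word_class X R v"
  moreover have "u \<in> word_class X R u"
    using assms by (simp add: word_class_def word_cong.refl)
  ultimately have "word_cong X R v u"
    by (simp add: word_class_def)
  then show "word_cong X R u v" by (rule word_cong.sym)
next
  assume "word_cong X R u v"
  then have "word_cong X R u w \<longleftrightarrow> word_cong X R v w" for w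
    by (meson word_cong.sym word_cong.trans)
  then show "word_class X R u = word_class X R v"
    by (simp add: word_class_def)
qed

lemma presented_group_mult:
  assumes "u \<in> words X" "v \<in> words X"
  shows "word_class X R u \<otimes>\<^bsub>presented_group X R\<^esub> word_class X R v = word_class X R (u @ v)"
proof -
  have "word_class X R (u' @ v') = word_class X R (u @ v)"
    if "u' \<in> word_class X R u" "v' \<in> word_class X R v" for u' v'
  proof -
    have "word_cong X R (u @ v) (u' @ v')"
      using that unfolding word_class_def by (simp add: word_cong.append)
    moreover have "u @ v \<in> words X" using assms by simp
    ultimately show ?thesis
      using word_class_eq_iff by metis
  qed
  moreover have "u \<in> word_class X R u" "v \<in> word_class X R v"
    using assms by (simp_all add: word_class_def word_cong.refl)
  ultimately have "(\<Union>u'\<in>word_class X R u. \<Union>v'\<in>word_class X R v. word_class X R (u' @ v')) =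
      word_class X R (u @ v)"
    by blast
  then show ?thesis
    by (simp add: presented_group_def)
qed

lemma word_cong_inverse:
  assumes "u \<in> words X"
  shows "word_cong X R (map (map_prod id Not) (rev u) @ u) []"
  using assms
proof (induction u rule: list.induct)
  case Nil
  then show ?case by (simp add: word_cong.refl)
next
  case (Cons l u)
  obtain x b where l: "l = (x, b)" by force
  let ?w = "map (map_prod id Not) (rev u)"
  from Cons.prems[unfolded l] have x: "x \<in> X" and u: "u \<in> words X" by simp_all
  have w: "?w \<in> words X" using u by (auto simp: in_lists_conv_set)
  have "word_cong X R ([(x, \<not> b), (x, \<not> \<not> b)] @ u) ([] @ u)"
    by (rule word_cong.append[OF word_cong.cancel[OF x] word_cong.refl[OF u]])
  from word_cong.append[OF word_cong.refl[OF w] this]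
  have "word_cong X R (?w @ [(x, \<not> b), (x, b)] @ u) (?w @ u)" by simp
  then have "word_cong X R (?w @ [(x, \<not> b), (x, b)] @ u) []"
    using Cons.IH[OF u] by (rule word_cong.trans)
  then show ?case by (simp add: l id_def)
qed

lemma group_presented_group: "group (presented_group X R)"
proof (rule groupI)
  let ?G = "presented_group X R"
  have carrier: "carrier ?G = word_class X R ` words X"
    and one: "\<one>\<^bsub>?G\<^esub> = word_class X R []"
    by (simp_all add: presented_group_def)
  show "\<one>\<^bsub>?G\<^esub> \<in> carrier ?G" unfolding carrier one by auto
  fix A assume "A \<in> carrier ?G"
  then obtain u where u: "u \<in> words X" "A = word_class X R u" unfolding carrier by auto
  show "\<one>\<^bsub>?G\<^esub> \<otimes>\<^bsub>?G\<^esub> A = A"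
    using u by (simp add: one presented_group_mult)
  show "\<exists>B\<in>carrier ?G. B \<otimes>\<^bsub>?G\<^esub> A = \<one>\<^bsub>?G\<^esub>"
  proof
    let ?w = "map (map_prod id Not) (rev u)"
    have w: "?w \<in> words X" using u by (auto simp: in_lists_conv_set)
    then show "word_class X R ?w \<in> carrier ?G" unfolding carrier by blast
    have "word_class X R (?w @ u) = word_class X R []"
      using u w word_cong_inverse[OF u(1)] by (subst word_class_eq_iff) auto
    then show "word_class X R ?w \<otimes>\<^bsub>?G\<^esub> A = \<one>\<^bsub>?G\<^esub>"
      using u w by (simp add: one presented_group_mult)
  qed
  fix B assume "B \<in> carrier ?G"
  then obtain v where v: "v \<in> words X" "B = word_class X R v" unfolding carrier by auto
  show "A \<otimes>\<^bsub>?G\<^esub> B \<in> carrier ?G"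
    using u v by (auto simp: carrier presented_group_mult)
  fix C assume "C \<in> carrier ?G"
  then obtain w where w: "w \<in> words X" "C = word_class X R w" unfolding carrier by auto
  show "A \<otimes>\<^bsub>?G\<^esub> B \<otimes>\<^bsub>?G\<^esub> C = A \<otimes>\<^bsub>?G\<^esub> (B \<otimes>\<^bsub>?G\<^esub> C)"
    using u v w by (simp add: presented_group_mult)
qed


section \<open>Simplicial complexes and the Coxeter complex of type \<open>\<tilde>A\<^sub>2\<close>\<close>

text \<open>Complexes are represented by their sets of nonempty simplices.\<close>

definition faces :: "'v set set \<Rightarrow> 'v set set" where
  "faces C = {s. s \<noteq> {} \<and> (\<exists>c\<in>C. s \<subseteq> c)}"

definition simplicial_iso :: "('v \<Rightarrow> 'w) \<Rightarrow> 'v set set \<Rightarrow> 'w set set \<Rightarrow> bool" where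
  "simplicial_iso f K M \<longleftrightarrow> inj_on f (\<Union>K) \<and> (`) f ` K = M"

text \<open>The pair \<open>(m, n)\<close> stands for the point \<open>m + n exp(i \<pi> / 3)\<close> of the Euclidean plane,
  tessellated by equilateral triangles of side 1.\<close>

definition coxeter_chambers :: "(int \<times> int) set set" where
  "coxeter_chambers =
     {{(m, n), (m + 1, n), (m, n + 1)} | m n. True} \<union>
     {{(m + 1, n), (m, n + 1), (m + 1, n + 1)} | m n. True}"

definition coxeter_complex :: "(int \<times> int) set set" where
  "coxeter_complex = faces coxeter_chambers"

definition lattice_point ::
  "int \<times> int \<Rightarrow> int \<times> int \<Rightarrow> int \<times> int \<Rightarrow> int \<Rightarrow> int \<Rightarrow> int \<times> int" where
  "lattice_point p u w i j =
     (fst p + i * fst u + j * fst w, snd p + i * snd u + j * snd w)"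

text \<open>\<open>u\<close> and \<open>w\<close> are unit steps at an angle of 60 degrees. For each \<open>p\<close>, the six unordered
  pairs \<open>{u, w}\<close> give the six cones based at \<open>p\<close>.\<close>

definition sector_steps :: "int \<times> int \<Rightarrow> int \<times> int \<Rightarrow> bool" where
  "sector_steps u w \<longleftrightarrow> u \<noteq> w \<and> u \<noteq> 0 \<and> w \<noteq> 0 \<and> {0, u, w} \<in> coxeter_chambers"

definition cone :: "int \<times> int \<Rightarrow> int \<times> int \<Rightarrow> int \<times> int \<Rightarrow> (int \<times> int) set set" where
  "cone p u w =
     {s \<in> coxeter_complex. s \<subseteq> {lattice_point p u w i j | i j. i \<ge> 0 \<and> j \<ge> 0}}"


section \<open>The group, the building and its boundary\<close>

context
  fixes P :: "'p set" and T :: "('p \<times> 'p \<times> 'p) set"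
begin

definition triangle_relators :: "'p word set" where
  "triangle_relators = {[(x, True), (y, True), (z, True)] | x y z. (x, y, z) \<in> T}"

definition triangle_group :: "'p word set monoid" (\<open>\<Gamma>\<close>) where
  "\<Gamma> = presented_group P triangle_relators"

definition triangle_gen :: "'p \<Rightarrow> 'p word set" where
  "triangle_gen x = word_class P triangle_relators [(x, True)]"

definition building_chambers :: "'p word set set set" where
  "building_chambers =
     {{g, g \<otimes>\<^bsub>\<Gamma>\<^esub> inv\<^bsub>\<Gamma>\<^esub> triangle_gen x, g \<otimes>\<^bsub>\<Gamma>\<^esub> triangle_gen y} | g x y z.
        g \<in> carrier \<Gamma> \<and> (x, y, z) \<in> T}"

definition triangle_building :: "'p word set set set" where
  "triangle_building = faces building_chambers"

definition oriented_edge :: "'p word set \<Rightarrow> 'p word set \<Rightarrow> bool" where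
  "oriented_edge g h \<longleftrightarrow> g \<in> carrier \<Gamma> \<and> (\<exists>x\<in>P. h = g \<otimes>\<^bsub>\<Gamma>\<^esub> triangle_gen x)"

definition apartment :: "'p word set set set \<Rightarrow> bool" where
  "apartment A \<longleftrightarrow>
     A \<subseteq> triangle_building \<and> (\<exists>f. simplicial_iso f coxeter_complex A)"

definition sectors :: "'p word set set set set" where
  "sectors = {S. \<exists>A f p u w. apartment A \<and> simplicial_iso f coxeter_complex A \<and>
     sector_steps u w \<and> S = (`) f ` cone p u w}"

definition sector_equiv :: "('p word set set set \<times> 'p word set set set) set" where
  "sector_equiv = {(S, S'). S \<in> sectors \<and> S' \<in> sectors \<and>
     (\<exists>R\<in>sectors. R \<subseteq> S \<and> R \<subseteq> S')}"

definition building_boundary :: "'p word set set set set set" where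
  "building_boundary = sectors // sector_equiv"

definition translate_sector :: "'p word set \<Rightarrow> 'p word set set set \<Rightarrow> 'p word set set set" where
  "translate_sector g S = (`) (\<lambda>h. g \<otimes>\<^bsub>\<Gamma>\<^esub> h) ` S"

definition boundary_act ::
  "'p word set \<Rightarrow> 'p word set set set set \<Rightarrow> 'p word set set set set" where
  "boundary_act g \<omega> = translate_sector g ` \<omega>"


section \<open>Periodic sectors\<close>

text \<open>\<open>a i j\<close> is the vertex of \<open>S\<close> with coordinates \<open>i, j\<close>, where the first bounding ray
  (steps \<open>u\<close>) is oriented away from the base vertex and the second one (steps \<open>w\<close>)
  towards it. Only the values at \<open>i, j \<ge> 0\<close> matter.\<close>

definition sector_labelling ::
  "'p word set set set \<Rightarrow> (int \<Rightarrow> int \<Rightarrow> 'p word set) \<Rightarrow> bool" where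
  "sector_labelling S a \<longleftrightarrow>
     (\<exists>A f p u w. apartment A \<and> simplicial_iso f coxeter_complex A \<and>
        sector_steps u w \<and> S = (`) f ` cone p u w \<and>
        (\<forall>i\<ge>0. \<forall>j\<ge>0. a i j = f (lattice_point p u w i j))) \<and>
     (\<forall>i\<ge>0. oriented_edge (a i 0) (a (i + 1) 0)) \<and>
     (\<forall>j\<ge>0. oriented_edge (a 0 (j + 1)) (a 0 j))"

definition periodic_labelling :: "int \<Rightarrow> int \<Rightarrow> (int \<Rightarrow> int \<Rightarrow> 'p word set) \<Rightarrow> bool" where
  "periodic_labelling r s a \<longleftrightarrow>
     (\<forall>i j k l. i \<ge> 0 \<and> j \<ge> 0 \<and> k \<ge> 0 \<and> l \<ge> 0 \<and>
        i + r \<ge> 0 \<and> j + s \<ge> 0 \<and> k + r \<ge> 0 \<and> l + s \<ge> 0 \<longrightarrow>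
        inv\<^bsub>\<Gamma>\<^esub> (a i j) \<otimes>\<^bsub>\<Gamma>\<^esub> a k l =
        inv\<^bsub>\<Gamma>\<^esub> (a (i + r) (j + s)) \<otimes>\<^bsub>\<Gamma>\<^esub> a (k + r) (l + s))"

definition periodic_sector :: "'p word set set set \<Rightarrow> bool" where
  "periodic_sector S \<longleftrightarrow>
     (\<exists>a r s. sector_labelling S a \<and> (r, s) \<noteq> (0, 0) \<and> periodic_labelling r s a)"

definition periodic_limit_points :: "'p word set set set set set" where
  "periodic_limit_points = {\<omega> \<in> building_boundary. \<exists>S\<in>\<omega>. periodic_sector S}"

end

end

theory Submission
  imports Defs
begin

text \<open>
  Fix a sector \<open>S\<close> in the class \<open>\<omega>\<close>. Since \<open>g\<close> fixes \<open>\<omega>\<close>, the sectors \<open>S\<close> and \<open>g S\<close> contain a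
  common subsector \<open>R\<close>, which again represents \<open>\<omega>\<close>. The vertices of a sector carry coordinates
  with non-negative entries, normalised so that the first wall is oriented away from the base
  vertex and the second one towards it. The point is that these coordinates are rigid: if \<open>R\<close> is
  contained in \<open>S\<close>, the coordinates on \<open>R\<close> differ from those on \<open>S\<close> by a translation
  (\<open>subsector_coordinates\<close>). If \<open>a\<close> and \<open>b\<close> are the coordinates on \<open>S\<close> and \<open>R\<close>, the two inclusions
  of \<open>R\<close> say \<open>b i j = a (i + m) (j + n)\<close> and \<open>b i j = g (a (i + m') (j + n'))\<close>. Hence
  \<open>b (i + r) (j + s) = g\<inverse> (b i j)\<close> for \<open>(r, s) = (m' - m, n' - n)\<close>, so left multiplication by
  \<open>g\<inverse>\<close> moves \<open>R\<close> along itself, which is periodicity of \<open>R\<close>. The shift \<open>(r, s)\<close> is not zero, as \<open>g\<close>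
  would then fix the vertex \<open>b 0 0\<close>, while \<open>\<Gamma>\<close> acts freely on the vertices.

  Rigidity rests on the orientation of the edges. Sending every generator to \<open>1\<close> defines a
  homomorphism from \<open>\<Gamma>\<close> to the integers modulo 3, because every relator has length 3; it gives each
  vertex a type, and an oriented edge raises the type by \<open>1\<close>. In particular no edge is oriented in
  both directions, and in normalised coordinates the vertex \<open>(i, j)\<close> of a sector has type
  \<open>c + i - j\<close> (\<open>sector_types\<close>). Comparing the coordinates of two nested sectors therefore gives
  an injective map of the quadrant that preserves oriented edges, and such a map is a translation
  (\<open>quadrant_map_is_translation\<close>): two triangles with a common edge must go to two different
  triangles with a common edge, so the map is affine, and positivity of the image fixes its
  linear part.
\<close>

section \<open>Oriented edges of the triangular lattice\<close>

text \<open>The oriented edges leaving a vertex when every triangle is oriented cyclically.\<close>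

definition forward_steps :: "(int \<times> int) set" where
  "forward_steps = {(1, 0), (-1, 1), (0, -1)}"

definition unit_steps :: "(int \<times> int) set" where
  "unit_steps = forward_steps \<union> {(-1, 0), (1, -1), (0, 1)}"

lemma quadrant_const:
  fixes h :: "int \<Rightarrow> int \<Rightarrow> 'b"
  assumes "\<And>i j. i \<ge> 0 \<Longrightarrow> j \<ge> 0 \<Longrightarrow> h (i + 1) j = h i j"
    and "\<And>i j. i \<ge> 0 \<Longrightarrow> j \<ge> 0 \<Longrightarrow> h i (j + 1) = h i j"
    and "i \<ge> 0" "j \<ge> 0"
  shows "h i j = h 0 0"
proof -
  have "h i j = h 0 j"
    using assms(3) by (induction i rule: int_ge_induct) (simp_all add: assms)
  also have "h 0 j = h 0 0"
    using assms(4) by (induction j rule: int_ge_induct) (simp_all add: assms)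
  finally show ?thesis .
qed

text \<open>The steps around a triangle are the three forward steps in one of the two cyclic orders
  (rotation by 120 degrees, called \<open>f\<close> below, or its inverse), so an edge lies on two triangles
  only, and their tips are symmetric about its midpoint.\<close>

lemma tips_over_common_edge:
  assumes "r - q \<in> forward_steps"
    and "p - r \<in> forward_steps" "q - p \<in> forward_steps"
    and "s - r \<in> forward_steps" "q - s \<in> forward_steps"
    and "p \<noteq> s"
  shows "p + s = q + r"
proof -
  have triangle: "(y, z) \<in> {(f x, f (f x)), (f (f x), f x)}"
    if "x \<in> forward_steps" "y \<in> forward_steps" "z \<in> forward_steps" "x + y + z = 0"
      and f: "f = (\<lambda>(m, n). (- m - n, m))"
    for x y z :: "int \<times> int" and f
    using that(1-4) unfolding f forward_steps_def zero_prod_def by auto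
  define f :: "int \<times> int \<Rightarrow> int \<times> int" where "f = (\<lambda>(m, n). (- m - n, m))"
  have "(p - r, q - p) \<in> {(f (r - q), f (f (r - q))), (f (f (r - q)), f (r - q))}"
    "(s - r, q - s) \<in> {(f (r - q), f (f (r - q))), (f (f (r - q)), f (r - q))}"
    by (rule triangle[OF _ _ _ _ f_def]; use assms in simp)+
  moreover have "p - r \<noteq> s - r" using assms(6) by simp
  ultimately have "p - r = q - s" by (metis insertE empty_iff prod.inject)
  then show ?thesis by (simp add: algebra_simps)
qed

text \<open>Symmetry of tips about the three kinds of edges says that all second differences vanish.\<close>

lemma quadrant_map_is_translation:
  fixes \<psi> :: "int \<Rightarrow> int \<Rightarrow> int \<times> int"
  assumes nonneg: "\<And>i j. i \<ge> 0 \<Longrightarrow> j \<ge> 0 \<Longrightarrow> fst (\<psi> i j) \<ge> 0 \<and> snd (\<psi> i j) \<ge> 0"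
    and inj: "\<And>i j k l. \<lbrakk>i \<ge> 0; j \<ge> 0; k \<ge> 0; l \<ge> 0; \<psi> i j = \<psi> k l\<rbrakk> \<Longrightarrow> i = k \<and> j = l"
    and step: "\<And>i j k l. \<lbrakk>i \<ge> 0; j \<ge> 0; k \<ge> 0; l \<ge> 0; (k - i, l - j) \<in> forward_steps\<rbrakk>
      \<Longrightarrow> \<psi> k l - \<psi> i j \<in> forward_steps"
    and ij: "i \<ge> 0" "j \<ge> 0"
  shows "\<psi> i j = \<psi> 0 0 + (i, j)"
proof -
  have rhombus: "\<psi> i j + \<psi> (i + 1) (j + 1) = \<psi> (i + 1) j + \<psi> i (j + 1)"
    if "i \<ge> 0" "j \<ge> 0" for i j
  proof (rule tips_over_common_edge)
    show "\<psi> i j \<noteq> \<psi> (i + 1) (j + 1)" using inj[of i j "i + 1" "j + 1"] that by auto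
  qed (rule step; use that in \<open>simp add: forward_steps_def\<close>)+
  have vertical: "\<psi> (i + 1) j + \<psi> i (j + 2) = \<psi> i (j + 1) + \<psi> (i + 1) (j + 1)"
    if "i \<ge> 0" "j \<ge> 0" for i j
  proof (rule tips_over_common_edge)
    show "\<psi> (i + 1) j \<noteq> \<psi> i (j + 2)" using inj[of "i + 1" j i "j + 2"] that by auto
  qed (rule step; use that in \<open>simp add: forward_steps_def\<close>)+
  have horizontal: "\<psi> i (j + 1) + \<psi> (i + 2) j = \<psi> (i + 1) (j + 1) + \<psi> (i + 1) j"
    if "i \<ge> 0" "j \<ge> 0" for i j
  proof (rule tips_over_common_edge)
    show "\<psi> i (j + 1) \<noteq> \<psi> (i + 2) j" using inj[of i "j + 1" "i + 2" j] that by auto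
  qed (rule step; use that in \<open>simp add: forward_steps_def\<close>)+

  define d where "d = \<psi> 1 0 - \<psi> 0 0"
  define e where "e = \<psi> 0 1 - \<psi> 0 0"
  have d: "\<psi> (i + 1) j - \<psi> i j = d" if "i \<ge> 0" "j \<ge> 0" for i j
  proof -
    have "\<psi> (i + 1 + 1) j - \<psi> (i + 1) j = \<psi> (i + 1) j - \<psi> i j" if "i \<ge> 0" "j \<ge> 0" for i j
      using rhombus[OF that] horizontal[OF that] by (simp add: algebra_simps prod_eq_iff)
    moreover have "\<psi> (i + 1) (j + 1) - \<psi> i (j + 1) = \<psi> (i + 1) j - \<psi> i j"
      if "i \<ge> 0" "j \<ge> 0" for i j
      using rhombus[OF that] by (simp add: algebra_simps prod_eq_iff)
    ultimately have "\<psi> (i + 1) j - \<psi> i j = \<psi> (0 + 1) 0 - \<psi> 0 0"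
      by (rule quadrant_const) (use that in auto)
    then show ?thesis by (simp add: d_def)
  qed
  have e: "\<psi> i (j + 1) - \<psi> i j = e" if "i \<ge> 0" "j \<ge> 0" for i j
  proof -
    have "\<psi> (i + 1) (j + 1) - \<psi> (i + 1) j = \<psi> i (j + 1) - \<psi> i j" if "i \<ge> 0" "j \<ge> 0" for i j
      using rhombus[OF that] by (simp add: algebra_simps prod_eq_iff)
    moreover have "\<psi> i (j + 1 + 1) - \<psi> i (j + 1) = \<psi> i (j + 1) - \<psi> i j"
      if "i \<ge> 0" "j \<ge> 0" for i j
      using rhombus[OF that] vertical[OF that] by (simp add: algebra_simps prod_eq_iff)
    ultimately have "\<psi> i (j + 1) - \<psi> i j = \<psi> 0 (0 + 1) - \<psi> 0 0"
      by (rule quadrant_const) (use that in auto)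
    then show ?thesis by (simp add: e_def)
  qed

  have affine: "\<psi> i j - (i * fst d + j * fst e, i * snd d + j * snd e) = \<psi> 0 0"
    if "i \<ge> 0" "j \<ge> 0" for i j
  proof -
    let ?h = "\<lambda>i j. \<psi> i j - (i * fst d + j * fst e, i * snd d + j * snd e)"
    have "?h (i + 1) j = ?h i j" if "i \<ge> 0" "j \<ge> 0" for i j
      using d[OF that] by (auto simp add: algebra_simps prod_eq_iff)
    moreover have "?h i (j + 1) = ?h i j" if "i \<ge> 0" "j \<ge> 0" for i j
      using e[OF that] by (auto simp add: algebra_simps prod_eq_iff)
    ultimately have "?h i j = ?h 0 0"
      by (rule quadrant_const) (use that in auto)
    then show ?thesis by (simp add: prod_eq_iff)
  qed

  \<comment> \<open>A negative entry of \<open>d\<close> or \<open>e\<close> would lead out of the quadrant after \<open>X\<close> or \<open>Y\<close> steps in that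
    direction. Only \<open>(1, 0)\<close> among the forward steps and only \<open>(0, 1)\<close> among their negatives have
    non-negative entries.\<close>
  have d_step: "d \<in> forward_steps"
    unfolding d_def by (rule step) (simp_all add: forward_steps_def)
  have e_step: "- e \<in> forward_steps"
    using step[of 0 1 0 0] by (simp add: e_def forward_steps_def)
  define X where "X = fst (\<psi> 0 0) + 1"
  define Y where "Y = snd (\<psi> 0 0) + 1"
  have XY: "X \<ge> 0" "Y \<ge> 0" using nonneg[of 0 0] by (simp_all add: X_def Y_def)
  have linear: "fst (\<psi> i j) = X - 1 + i * fst d + j * fst e"
    "snd (\<psi> i j) = Y - 1 + i * snd d + j * snd e" if "i \<ge> 0" "j \<ge> 0" for i j
    using affine[OF that] by (simp_all add: X_def Y_def prod_eq_iff)
  have "X - 1 + X * fst d \<ge> 0" "Y - 1 + Y * snd d \<ge> 0"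
    using nonneg[of X 0] nonneg[of Y 0] linear[of X 0] linear[of Y 0] XY by simp_all
  then have "d = (1, 0)"
    using d_step by (auto simp: forward_steps_def)
  moreover have "X - 1 + X * fst e \<ge> 0" "Y - 1 + Y * snd e \<ge> 0"
    using nonneg[of 0 X] nonneg[of 0 Y] linear[of 0 X] linear[of 0 Y] XY by simp_all
  then have "e = (0, 1)"
    using e_step by (cases e) (auto simp: forward_steps_def)
  ultimately show ?thesis
    using linear[OF ij] by (simp add: prod_eq_iff X_def Y_def)
qed


section \<open>Edges of the Coxeter complex\<close>

text \<open>The square of the Euclidean length of \<open>m + n exp(i \<pi> / 3)\<close>. Describing unit steps by it
  makes the symmetry of the tessellation under changes of basis an identity of quadratic forms.\<close>

definition sq_length :: "int \<times> int \<Rightarrow> int" where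
  "sq_length x = fst x * fst x + fst x * snd x + snd x * snd x"

lemma sq_length_snd_bound:
  fixes m n :: int
  assumes "m * m + m * n + n * n \<le> 1"
  shows "\<bar>n\<bar> \<le> 1"
proof (rule ccontr)
  assume "\<not> \<bar>n\<bar> \<le> 1"
  then have "2 * 2 \<le> \<bar>n\<bar> * \<bar>n\<bar>" by (intro mult_mono) auto
  then have "4 \<le> n * n" by simp
  moreover have "(2 * m + n) * (2 * m + n) + 3 * (n * n) \<le> 4"
    using assms by (simp add: algebra_simps)
  ultimately show False using zero_le_square[of "2 * m + n"] by linarith
qed

lemma sq_length_small:
  assumes "sq_length (m, n) \<le> 1"
  shows "(m, n) \<in> insert (0, 0) unit_steps"
proof -
  have "\<bar>n\<bar> \<le> 1" "\<bar>m\<bar> \<le> 1"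
    using assms sq_length_snd_bound[of m n] sq_length_snd_bound[of n m]
    by (simp_all add: sq_length_def algebra_simps)
  then have "m \<in> {-1, 0, 1}" "n \<in> {-1, 0, 1}" by auto
  then show ?thesis
    using assms by (elim insertE emptyE) (simp_all add: sq_length_def unit_steps_def forward_steps_def)
qed

lemma unit_steps_iff: "x \<in> unit_steps \<longleftrightarrow> sq_length x = 1"
proof
  show "x \<in> unit_steps \<Longrightarrow> sq_length x = 1"
    by (auto simp: sq_length_def unit_steps_def forward_steps_def)
  show "sq_length x = 1 \<Longrightarrow> x \<in> unit_steps"
    using sq_length_small[of "fst x" "snd x"] by (auto simp: sq_length_def)
qed

lemma sq_length_eq_0: "sq_length x = 0 \<longleftrightarrow> x = (0, 0)"
proof
  assume "sq_length x = 0"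
  then show "x = (0, 0)"
    using sq_length_small[of "fst x" "snd x"] unit_steps_iff[of x] by simp
qed (simp add: sq_length_def)

lemma coxeter_edge_iff:
  "{x, y} \<in> coxeter_complex \<and> x \<noteq> y \<longleftrightarrow> y - x \<in> unit_steps"
proof
  assume xy: "{x, y} \<in> coxeter_complex \<and> x \<noteq> y"
  then obtain c where "c \<in> coxeter_chambers" "x \<in> c" "y \<in> c"
    by (auto simp: coxeter_complex_def faces_def)
  with xy show "y - x \<in> unit_steps"
    unfolding coxeter_chambers_def by (auto simp: unit_steps_iff sq_length_def)
next
  assume *: "y - x \<in> unit_steps"
  obtain x1 x2 where x: "x = (x1, x2)" by (metis surj_pair)
  have y: "y = x + (y - x)" by simp
  have up: "{(m, n), (m + 1, n), (m, n + 1)} \<in> coxeter_chambers" for m n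
    unfolding coxeter_chambers_def by blast
  have "\<exists>c\<in>coxeter_chambers. x \<in> c \<and> y \<in> c"
  proof -
    from * consider "y - x = (1, 0)" | "y - x = (-1, 1)" | "y - x = (0, -1)"
      | "y - x = (-1, 0)" | "y - x = (1, -1)" | "y - x = (0, 1)"
      unfolding unit_steps_def forward_steps_def by blast
    then have "y = (x1 + 1, x2) \<or> y = (x1 - 1, x2 + 1) \<or> y = (x1, x2 - 1)
      \<or> y = (x1 - 1, x2) \<or> y = (x1 + 1, x2 - 1) \<or> y = (x1, x2 + 1)"
      by cases (subst y; simp add: x)+
    then consider "y = (x1 + 1, x2)" | "y = (x1 - 1, x2 + 1)" | "y = (x1, x2 - 1)"
      | "y = (x1 - 1, x2)" | "y = (x1 + 1, x2 - 1)" | "y = (x1, x2 + 1)"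
      by blast
    then show ?thesis
    proof cases
      case 1 then show ?thesis using up[of x1 x2] x by blast
    next
      case 2 then show ?thesis by (intro bexI[OF _ up[of "x1 - 1" x2]]) (simp add: x)
    next
      case 3 then show ?thesis by (intro bexI[OF _ up[of x1 "x2 - 1"]]) (simp add: x)
    next
      case 4 then show ?thesis by (intro bexI[OF _ up[of "x1 - 1" x2]]) (simp add: x)
    next
      case 5 then show ?thesis by (intro bexI[OF _ up[of x1 "x2 - 1"]]) (simp add: x)
    next
      case 6 then show ?thesis using up[of x1 x2] x by blast
    qed
  qed
  moreover have "x \<noteq> y"
    using * by (auto simp: unit_steps_iff sq_length_def)
  ultimately show "{x, y} \<in> coxeter_complex \<and> x \<noteq> y"
    by (auto simp: coxeter_complex_def faces_def)
qed

lemma sector_steps_unit: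
  assumes "sector_steps u w"
  shows "u \<in> unit_steps" "w \<in> unit_steps" "w - u \<in> unit_steps"
proof -
  have "{0, u} \<in> coxeter_complex" "{0, w} \<in> coxeter_complex" "{u, w} \<in> coxeter_complex"
    using assms unfolding sector_steps_def coxeter_complex_def faces_def by blast+
  then show "u \<in> unit_steps" "w \<in> unit_steps" "w - u \<in> unit_steps"
    using assms coxeter_edge_iff[of 0 u] coxeter_edge_iff[of 0 w] coxeter_edge_iff[of u w]
    by (auto simp: sector_steps_def)
qed

text \<open>Two unit steps at an angle of 60 degrees are a basis in which the length form has the same
  coefficients as in the standard basis: the mixed coefficient \<open>B\<close> is read off from the length of
  the third side \<open>w - u\<close>.\<close>

lemma sq_length_sector_coordinates:
  assumes "sector_steps u w"
  shows "sq_length (i * fst u + j * fst w, i * snd u + j * snd w) = sq_length (i, j)"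
proof -
  note unit = sector_steps_unit[OF assms, unfolded unit_steps_iff]
  define B where "B = 2 * fst u * fst w + fst u * snd w + snd u * fst w + 2 * snd u * snd w"
  have "sq_length (w - u) = sq_length w + sq_length u - B"
    by (simp add: sq_length_def B_def algebra_simps)
  then have "B = 1" using unit by simp
  moreover have "sq_length (i * fst u + j * fst w, i * snd u + j * snd w) =
      i * i * sq_length u + i * j * B + j * j * sq_length w"
    by (simp add: sq_length_def B_def algebra_simps)
  ultimately show ?thesis using unit by simp (simp add: sq_length_def)
qed

lemma lattice_point_edge_iff:
  assumes "sector_steps u w"
  shows "{lattice_point p u w i j, lattice_point p u w k l} \<in> coxeter_complex
      \<and> lattice_point p u w i j \<noteq> lattice_point p u w k l \<longleftrightarrow> (k - i, l - j) \<in> unit_steps"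
proof -
  have "lattice_point p u w k l - lattice_point p u w i j =
      ((k - i) * fst u + (l - j) * fst w, (k - i) * snd u + (l - j) * snd w)"
    by (simp add: lattice_point_def algebra_simps)
  then show ?thesis
    unfolding coxeter_edge_iff
    using sq_length_sector_coordinates[OF assms, of "k - i" "l - j"] by (simp add: unit_steps_iff)
qed

lemma lattice_point_inj:
  assumes "sector_steps u w" "lattice_point p u w i j = lattice_point p u w k l"
  shows "i = k \<and> j = l"
proof -
  have "((k - i) * fst u + (l - j) * fst w, (k - i) * snd u + (l - j) * snd w) = (0, 0)"
    using assms(2) by (simp add: lattice_point_def algebra_simps)
  then have "sq_length (k - i, l - j) = 0"
    using sq_length_sector_coordinates[OF assms(1), of "k - i" "l - j"] by (simp add: sq_length_def)
  then show ?thesis by (simp add: sq_length_eq_0)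
qed

lemma sector_steps_swap: "sector_steps u w \<Longrightarrow> sector_steps w u"
  by (auto simp: sector_steps_def insert_commute)

lemma lattice_point_swap: "lattice_point p u w i j = lattice_point p w u j i"
  by (simp add: lattice_point_def algebra_simps)

lemma cone_swap: "cone p u w = cone p w u"
proof -
  have "{lattice_point p u w i j |i j. i \<ge> 0 \<and> j \<ge> 0} = {lattice_point p w u i j |i j. i \<ge> 0 \<and> j \<ge> 0}"
    by (subst lattice_point_swap) blast
  then show ?thesis by (simp add: cone_def)
qed


section \<open>Vertex types\<close>

definition exponent_sum :: "'a word \<Rightarrow> int" where
  "exponent_sum u = (\<Sum>(x, b)\<leftarrow>u. if b then 1 else -1)"

lemma exponent_sum_word_cong:
  assumes "word_cong X (triangle_relators T) u v"
  shows "exponent_sum u mod 3 = exponent_sum v mod 3"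
  using assms
proof (induction rule: word_cong.induct)
  case (append u u' v v')
  have "(exponent_sum u + exponent_sum v) mod 3 = (exponent_sum u' + exponent_sum v') mod 3"
    using append.IH by (rule mod_add_cong)
  then show ?case by (simp add: exponent_sum_def)
next
  case (cancel x b)
  then show ?case by (cases b) (simp_all add: exponent_sum_def)
next
  case (relator r)
  then show ?case by (auto simp: exponent_sum_def triangle_relators_def)
qed simp_all

definition vertex_type :: "'a word set \<Rightarrow> int" where
  "vertex_type v = exponent_sum (SOME u. u \<in> v) mod 3"

lemma vertex_type_class:
  assumes "u \<in> words P"
  shows "vertex_type (word_class P (triangle_relators T) u) = exponent_sum u mod 3"
proof -
  let ?A = "word_class P (triangle_relators T) u"
  have "u \<in> ?A" using assms by (simp add: word_class_def word_cong.refl)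
  then have "(SOME v. v \<in> ?A) \<in> ?A" by (rule someI)
  then have "word_cong P (triangle_relators T) u (SOME v. v \<in> ?A)"
    by (simp add: word_class_def)
  from exponent_sum_word_cong[OF this] show ?thesis by (simp add: vertex_type_def)
qed

lemma oriented_edge_type:
  assumes "oriented_edge P T v w"
  shows "(vertex_type w - vertex_type v) mod 3 = 1" "(vertex_type v - vertex_type w) mod 3 = 2"
proof -
  from assms obtain u x where "x \<in> P" "u \<in> words P" "v = word_class P (triangle_relators T) u"
      "w = v \<otimes>\<^bsub>triangle_group P T\<^esub> triangle_gen P T x"
    by (auto simp: oriented_edge_def triangle_group_def presented_group_def)
  then have v: "vertex_type v = exponent_sum u mod 3"
    and w: "w = word_class P (triangle_relators T) (u @ [(x, True)])"
    by (simp_all add: vertex_type_class triangle_group_def triangle_gen_def presented_group_mult)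
  have "vertex_type w = exponent_sum (u @ [(x, True)]) mod 3"
    unfolding w using \<open>x \<in> P\<close> \<open>u \<in> words P\<close> by (intro vertex_type_class) auto
  then have "(vertex_type w - vertex_type v) mod 3 = (exponent_sum u + 1 - exponent_sum u) mod 3"
    using v by (simp add: exponent_sum_def mod_diff_eq)
  then show *: "(vertex_type w - vertex_type v) mod 3 = 1" by simp
  have "(vertex_type v - vertex_type w) mod 3 = (- ((vertex_type w - vertex_type v) mod 3)) mod 3"
    unfolding mod_minus_eq by simp
  with * show "(vertex_type v - vertex_type w) mod 3 = 2" by simp
qed


section \<open>Sectors in oriented coordinates\<close>

context
  fixes P :: "'p set" and T :: "('p \<times> 'p \<times> 'p) set"
  assumes T_subset: "T \<subseteq> P \<times> P \<times> P"
begin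

private abbreviation (input) G where "G \<equiv> triangle_group P T"

interpretation G: group G
  unfolding triangle_group_def by (rule group_presented_group)

lemma triangle_gen_closed: "x \<in> P \<Longrightarrow> triangle_gen P T x \<in> carrier G"
  by (auto simp: triangle_group_def presented_group_def triangle_gen_def)

lemma triangle_relation:
  assumes "(x, y, z) \<in> T"
  shows "triangle_gen P T x \<otimes>\<^bsub>G\<^esub> triangle_gen P T y \<otimes>\<^bsub>G\<^esub> triangle_gen P T z = \<one>\<^bsub>G\<^esub>"
proof -
  have xyz: "x \<in> P" "y \<in> P" "z \<in> P" using assms T_subset by auto
  have "word_cong P (triangle_relators T) [(x, True), (y, True), (z, True)] []"
    by (rule word_cong.relator) (use assms xyz in \<open>auto simp: triangle_relators_def\<close>)
  then have "word_class P (triangle_relators T) [(x, True), (y, True), (z, True)] =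
      word_class P (triangle_relators T) []"
    using xyz by (subst word_class_eq_iff) auto
  then show ?thesis
    using xyz by (simp add: triangle_gen_def triangle_group_def presented_group_mult)
      (simp add: presented_group_def)
qed

lemma oriented_edge_closed:
  assumes "oriented_edge P T v w"
  shows "v \<in> carrier G" "w \<in> carrier G"
  using assms by (auto simp: oriented_edge_def triangle_gen_closed)

lemma oriented_edge_translate:
  assumes "h \<in> carrier G" "oriented_edge P T v w"
  shows "oriented_edge P T (h \<otimes>\<^bsub>G\<^esub> v) (h \<otimes>\<^bsub>G\<^esub> w)"
proof -
  from assms(2) obtain x where "x \<in> P" "v \<in> carrier G" "w = v \<otimes>\<^bsub>G\<^esub> triangle_gen P T x"
    by (auto simp: oriented_edge_def)
  then show ?thesis
    using assms(1) by (auto simp: oriented_edge_def G.m_assoc triangle_gen_closed)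
qed

text \<open>The boundary of a chamber is the oriented triangle
  \<open>v a\<^sub>x\<inverse> \<rightarrow> v \<rightarrow> v a\<^sub>y \<rightarrow> v a\<^sub>y a\<^sub>z = v a\<^sub>x\<inverse>\<close>.\<close>

lemma building_edge_oriented:
  assumes "{v, w} \<in> triangle_building P T" "v \<noteq> w"
  shows "oriented_edge P T v w \<or> oriented_edge P T w v"
proof -
  from assms(1) obtain c where c: "c \<in> building_chambers P T" "{v, w} \<subseteq> c"
    by (auto simp: triangle_building_def faces_def)
  from c(1) obtain h x y z where h: "h \<in> carrier G" and xyz: "(x, y, z) \<in> T"
    and "c = {h, h \<otimes>\<^bsub>G\<^esub> inv\<^bsub>G\<^esub> triangle_gen P T x, h \<otimes>\<^bsub>G\<^esub> triangle_gen P T y}"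
    unfolding building_chambers_def mem_Collect_eq by blast
  with c(2)
  have vw: "{v, w} \<subseteq> {h, h \<otimes>\<^bsub>G\<^esub> inv\<^bsub>G\<^esub> triangle_gen P T x, h \<otimes>\<^bsub>G\<^esub> triangle_gen P T y}"
    by simp
  let ?x = "triangle_gen P T x" and ?y = "triangle_gen P T y" and ?z = "triangle_gen P T z"
  have P: "x \<in> P" "y \<in> P" "z \<in> P" using xyz T_subset by auto
  note closed = triangle_gen_closed[OF P(1)] triangle_gen_closed[OF P(2)] triangle_gen_closed[OF P(3)]
  have "h = h \<otimes>\<^bsub>G\<^esub> inv\<^bsub>G\<^esub> ?x \<otimes>\<^bsub>G\<^esub> ?x"
    using h closed by (simp add: G.m_assoc)
  then have 1: "oriented_edge P T (h \<otimes>\<^bsub>G\<^esub> inv\<^bsub>G\<^esub> ?x) h"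
    using h closed P by (auto simp: oriented_edge_def)
  have 2: "oriented_edge P T h (h \<otimes>\<^bsub>G\<^esub> ?y)"
    using h P by (auto simp: oriented_edge_def)
  have "?x \<otimes>\<^bsub>G\<^esub> (?y \<otimes>\<^bsub>G\<^esub> ?z) = \<one>\<^bsub>G\<^esub>"
    using triangle_relation[OF xyz] closed by (simp add: G.m_assoc)
  then have "inv\<^bsub>G\<^esub> ?x = ?y \<otimes>\<^bsub>G\<^esub> ?z"
    using closed by (metis G.inv_equality G.inv_inv G.m_closed)
  then have "h \<otimes>\<^bsub>G\<^esub> inv\<^bsub>G\<^esub> ?x = h \<otimes>\<^bsub>G\<^esub> ?y \<otimes>\<^bsub>G\<^esub> ?z"
    using h closed by (simp add: G.m_assoc)
  then have 3: "oriented_edge P T (h \<otimes>\<^bsub>G\<^esub> ?y) (h \<otimes>\<^bsub>G\<^esub> inv\<^bsub>G\<^esub> ?x)"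
    using h closed P by (auto simp: oriented_edge_def)
  from vw assms(2) 1 2 3 show ?thesis by auto
qed

lemma apartment_inj:
  assumes "simplicial_iso f coxeter_complex A"
  shows "inj f"
proof -
  have "\<Union> coxeter_complex = UNIV"
    using coxeter_edge_iff[of x "x + (1, 0)" for x]
    by (auto simp: unit_steps_def forward_steps_def)
  then show ?thesis using assms by (simp add: simplicial_iso_def)
qed

lemma sector_edge_oriented:
  assumes "apartment P T A" "simplicial_iso f coxeter_complex A" "sector_steps u w"
    and "(k - i, l - j) \<in> unit_steps"
  shows "oriented_edge P T (f (lattice_point p u w i j)) (f (lattice_point p u w k l))
    \<or> oriented_edge P T (f (lattice_point p u w k l)) (f (lattice_point p u w i j))"
proof (rule building_edge_oriented)
  let ?x = "lattice_point p u w i j" and ?y = "lattice_point p u w k l"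
  have xy: "{?x, ?y} \<in> coxeter_complex" "?x \<noteq> ?y"
    using assms(4) lattice_point_edge_iff[OF assms(3), of p i j k l] by simp_all
  then have "f ` {?x, ?y} \<in> A"
    using assms(2) unfolding simplicial_iso_def by blast
  then show "{f ?x, f ?y} \<in> triangle_building P T"
    using assms(1) by (auto simp: apartment_def)
  show "f ?x \<noteq> f ?y"
    using xy(2) apartment_inj[OF assms(2)] by (auto dest: injD)
qed

text \<open>The three vertices of a triangle have different types. Hence the type of the third vertex is
  determined by the other two, and one edge determines the types in the whole sector.\<close>

lemma sector_types:
  assumes "apartment P T A" "simplicial_iso f coxeter_complex A" "sector_steps u w"
    and base: "oriented_edge P T (f (lattice_point p u w 0 0)) (f (lattice_point p u w 1 0))"
    and "i \<ge> 0" "j \<ge> 0" "k \<ge> 0" "l \<ge> 0"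
  shows "(vertex_type (f (lattice_point p u w k l)) - vertex_type (f (lattice_point p u w i j))) mod 3
    = (k - i - (l - j)) mod 3"
proof -
  define t where "t = (\<lambda>i j. vertex_type (f (lattice_point p u w i j)))"
  have edge: "(t k l - t i j) mod 3 \<noteq> 0" if "(k - i, l - j) \<in> unit_steps" for i j k l
    using sector_edge_oriented[OF assms(1-3) that, of p] oriented_edge_type
    by (fastforce simp: t_def)
  \<comment> \<open>Three different residues modulo 3 add up to zero.\<close>
  have sum: "3 dvd x + y + z" if "(y - x) mod 3 \<noteq> 0" "(z - x) mod 3 \<noteq> 0" "(z - y) mod 3 \<noteq> 0"
    for x y z :: int
    using that by presburger
  have up: "3 dvd t i j + t (i + 1) j + t i (j + 1)" for i j
    by (intro sum edge; simp add: unit_steps_def forward_steps_def)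
  have down: "3 dvd t (i + 1) j + t i (j + 1) + t (i + 1) (j + 1)" for i j
    by (intro sum edge; simp add: unit_steps_def forward_steps_def)
  define \<delta> where "\<delta> = (\<lambda>i j. (t (i + 1) j - t i j) mod 3)"
  have "\<delta> (i + 1) j = \<delta> i j" for i j
  proof -
    have "3 dvd (t (i + 1) j + t (i + 1 + 1) j + t (i + 1) (j + 1))
        + (t i j + t (i + 1) j + t i (j + 1)) - (t (i + 1) j + t i (j + 1) + t (i + 1) (j + 1))
        - 3 * t (i + 1) j"
      by (rule dvd_diff[OF dvd_diff[OF dvd_add[OF up up] down]]) simp
    then show ?thesis unfolding \<delta>_def mod_eq_dvd_iff by (simp add: algebra_simps)
  qed
  moreover have "\<delta> i (j + 1) = \<delta> i j" for i j
  proof -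
    have "3 dvd (t (i + 1) j + t i (j + 1) + t (i + 1) (j + 1))
        - 2 * (t i j + t (i + 1) j + t i (j + 1)) + 3 * t i j"
      by (rule dvd_add[OF dvd_diff[OF down dvd_mult[OF up]]]) simp
    then show ?thesis unfolding \<delta>_def mod_eq_dvd_iff by (simp add: algebra_simps)
  qed
  ultimately have "\<delta> i j = \<delta> 0 0" if "i \<ge> 0" "j \<ge> 0" for i j
    using that by (intro quadrant_const) auto
  moreover have "\<delta> 0 0 = 1"
    using oriented_edge_type(1)[OF base] by (simp add: \<delta>_def t_def)
  ultimately have \<delta>: "\<delta> i j = 1" if "i \<ge> 0" "j \<ge> 0" for i j
    using that by simp
  have step: "3 dvd t (i + 1) j - t i j - 1" if "i \<ge> 0" "j \<ge> 0" for i j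
    using \<delta>[OF that] unfolding \<delta>_def by presburger
  have "(t (i + 1) j - (i + 1) + j) mod 3 = (t i j - i + j) mod 3" if "i \<ge> 0" "j \<ge> 0" for i j
    using step[OF that] unfolding mod_eq_dvd_iff by (simp add: algebra_simps)
  moreover have "(t i (j + 1) - i + (j + 1)) mod 3 = (t i j - i + j) mod 3"
    if "i \<ge> 0" "j \<ge> 0" for i j
  proof -
    have "3 dvd (t i j + t (i + 1) j + t i (j + 1)) - (t (i + 1) j - t i j - 1) - 3 * t i j"
      by (rule dvd_diff[OF dvd_diff[OF up step[OF that]]]) simp
    then show ?thesis unfolding mod_eq_dvd_iff by (simp add: algebra_simps)
  qed
  ultimately have "(t i j - i + j) mod 3 = (t 0 0 - 0 + 0) mod 3" if "i \<ge> 0" "j \<ge> 0" for i j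
    using that by (rule quadrant_const[where h = "\<lambda>i j. (t i j - i + j) mod 3"])
  from this[of k l] this[of i j] have "(t k l - k + l) mod 3 = (t i j - i + j) mod 3"
    using assms(5-8) by simp
  then show ?thesis unfolding t_def mod_eq_dvd_iff by (simp add: algebra_simps)
qed

lemma sector_has_labelling:
  assumes "S \<in> sectors P T"
  obtains a where "sector_labelling P T S a"
proof -
  from assms obtain A f p u w where A: "apartment P T A" "simplicial_iso f coxeter_complex A"
    and uw: "sector_steps u w" and S: "S = (`) f ` cone p u w"
    by (auto simp: sectors_def)
  \<comment> \<open>If the first wall starts towards the base vertex, the second one starts away from it, and
    exchanging the two leaves the cone unchanged.\<close>
  obtain u w where uw: "sector_steps u w" and S: "S = (`) f ` cone p u w"
    and base: "oriented_edge P T (f (lattice_point p u w 0 0)) (f (lattice_point p u w 1 0))"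
  proof (cases "oriented_edge P T (f (lattice_point p u w 0 0)) (f (lattice_point p u w 1 0))")
    case True
    with uw S that show ?thesis by blast
  next
    case False
    note edge = sector_edge_oriented[OF A uw, of _ _ _ _ p]
    have 1: "oriented_edge P T (f (lattice_point p u w 1 0)) (f (lattice_point p u w 0 0))"
      using False edge[of 1 0 0 0] by (auto simp: unit_steps_def forward_steps_def)
    have "oriented_edge P T (f (lattice_point p u w 0 0)) (f (lattice_point p u w 0 1))"
    proof (rule ccontr)
      assume "\<not> ?thesis"
      then have 2: "oriented_edge P T (f (lattice_point p u w 0 1)) (f (lattice_point p u w 0 0))"
        using edge[of 0 0 1 0] by (auto simp: unit_steps_def forward_steps_def)
      have "oriented_edge P T (f (lattice_point p u w 1 0)) (f (lattice_point p u w 0 1))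
        \<or> oriented_edge P T (f (lattice_point p u w 0 1)) (f (lattice_point p u w 1 0))"
        by (rule edge) (simp add: unit_steps_def forward_steps_def)
      moreover have "(z - y) mod 3 = 0" if "(x - y) mod 3 = 1" "(x - z) mod 3 = 1" for x y z :: int
        using mod_diff_eq[of "x - y" 3 "x - z"] that by simp
      from this[OF oriented_edge_type(1)[OF 1] oriented_edge_type(1)[OF 2]]
      have "(vertex_type (f (lattice_point p u w 0 1))
          - vertex_type (f (lattice_point p u w 1 0))) mod 3 = 0" .
      ultimately show False using oriented_edge_type by fastforce
    qed
    then have "oriented_edge P T (f (lattice_point p w u 0 0)) (f (lattice_point p w u 1 0))"
      by (simp add: lattice_point_swap[of p w u])
    with that[of w u] sector_steps_swap[OF uw] S cone_swap[of p u w] show ?thesis by auto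
  qed
  define a where "a = (\<lambda>i j. f (lattice_point p u w i j))"
  have types: "(vertex_type (a k l) - vertex_type (a i j)) mod 3 = (k - i - (l - j)) mod 3"
    if "i \<ge> 0" "j \<ge> 0" "k \<ge> 0" "l \<ge> 0" for i j k l
    unfolding a_def by (rule sector_types[OF A uw base that])
  have edge: "oriented_edge P T (a i j) (a k l) \<or> oriented_edge P T (a k l) (a i j)"
    if "(k - i, l - j) \<in> unit_steps" for i j k l
    unfolding a_def by (rule sector_edge_oriented[OF A uw that])
  have "oriented_edge P T (a i 0) (a (i + 1) 0)" if "i \<ge> 0" for i
  proof -
    have "oriented_edge P T (a i 0) (a (i + 1) 0) \<or> oriented_edge P T (a (i + 1) 0) (a i 0)"
      by (rule edge) (simp add: unit_steps_def forward_steps_def)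
    then show ?thesis
      using types[of i 0 "i + 1" 0] oriented_edge_type(2)[of P T "a (i + 1) 0" "a i 0"] that by auto
  qed
  moreover have "oriented_edge P T (a 0 (j + 1)) (a 0 j)" if "j \<ge> 0" for j
  proof -
    have "oriented_edge P T (a 0 (j + 1)) (a 0 j) \<or> oriented_edge P T (a 0 j) (a 0 (j + 1))"
      by (rule edge) (simp add: unit_steps_def forward_steps_def)
    then show ?thesis
      using types[of 0 "j + 1" 0 j] oriented_edge_type(2)[of P T "a 0 j" "a 0 (j + 1)"] that by auto
  qed
  ultimately have "sector_labelling P T S a"
    unfolding sector_labelling_def a_def using A uw S by blast
  then show thesis by (rule that)
qed

text \<open>What rigidity needs of a labelling, without reference to an apartment, so that it passes to
  translates at once.\<close>

definition oriented_coordinates ::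
  "'p word set set set \<Rightarrow> (int \<Rightarrow> int \<Rightarrow> 'p word set) \<Rightarrow> bool" where
  "oriented_coordinates S a \<longleftrightarrow>
     (\<forall>i\<ge>0. \<forall>j\<ge>0. a i j \<in> carrier G) \<and>
     (\<forall>i\<ge>0. \<forall>j\<ge>0. \<forall>k\<ge>0. \<forall>l\<ge>0. a i j = a k l \<longrightarrow> i = k \<and> j = l) \<and>
     (\<forall>v\<in>\<Union>S. \<exists>i\<ge>0. \<exists>j\<ge>0. v = a i j) \<and>
     (\<forall>i\<ge>0. \<forall>j\<ge>0. \<forall>k\<ge>0. \<forall>l\<ge>0.
        {a i j, a k l} \<in> S \<and> oriented_edge P T (a i j) (a k l) \<longleftrightarrow>
        (k - i, l - j) \<in> forward_steps)"

lemma oriented_coordinatesD: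
  assumes "oriented_coordinates S a"
  shows "i \<ge> 0 \<Longrightarrow> j \<ge> 0 \<Longrightarrow> a i j \<in> carrier G"
    and "\<lbrakk>a i j = a k l; i \<ge> 0; j \<ge> 0; k \<ge> 0; l \<ge> 0\<rbrakk> \<Longrightarrow> i = k \<and> j = l"
    and "v \<in> \<Union>S \<Longrightarrow> \<exists>i\<ge>0. \<exists>j\<ge>0. v = a i j"
    and "\<lbrakk>i \<ge> 0; j \<ge> 0; k \<ge> 0; l \<ge> 0\<rbrakk> \<Longrightarrow>
      {a i j, a k l} \<in> S \<and> oriented_edge P T (a i j) (a k l) \<longleftrightarrow> (k - i, l - j) \<in> forward_steps"
proof -
  note parts = assms[unfolded oriented_coordinates_def]
  show "i \<ge> 0 \<Longrightarrow> j \<ge> 0 \<Longrightarrow> a i j \<in> carrier G"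
    using parts[THEN conjunct1] by blast
  show "\<lbrakk>a i j = a k l; i \<ge> 0; j \<ge> 0; k \<ge> 0; l \<ge> 0\<rbrakk> \<Longrightarrow> i = k \<and> j = l"
    using parts[THEN conjunct2, THEN conjunct1] by blast
  show "v \<in> \<Union>S \<Longrightarrow> \<exists>i\<ge>0. \<exists>j\<ge>0. v = a i j"
    using parts[THEN conjunct2, THEN conjunct2, THEN conjunct1] by blast
  show "\<lbrakk>i \<ge> 0; j \<ge> 0; k \<ge> 0; l \<ge> 0\<rbrakk> \<Longrightarrow>
      {a i j, a k l} \<in> S \<and> oriented_edge P T (a i j) (a k l) \<longleftrightarrow> (k - i, l - j) \<in> forward_steps"
    using parts[THEN conjunct2, THEN conjunct2, THEN conjunct2] by simp
qed

text \<open>A unit step \<open>(m, n)\<close> is a forward step exactly if \<open>m - n\<close> is \<open>1\<close> modulo 3, and \<open>m - n\<close> is the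
  change of type along it. So the types decide how the edges of the sector are oriented.\<close>

lemma labelling_oriented_coordinates:
  assumes "sector_labelling P T S a"
  shows "oriented_coordinates S a"
proof -
  from assms obtain A f p u w where A: "apartment P T A" "simplicial_iso f coxeter_complex A"
    and uw: "sector_steps u w" and S: "S = (`) f ` cone p u w"
    and a: "\<And>i j. i \<ge> 0 \<Longrightarrow> j \<ge> 0 \<Longrightarrow> a i j = f (lattice_point p u w i j)"
    and base: "oriented_edge P T (a 0 0) (a (0 + 1) 0)"
    unfolding sector_labelling_def by blast
  let ?L = "lattice_point p u w"
  note inj = apartment_inj[OF A(2)]
  have types: "(vertex_type (a k l) - vertex_type (a i j)) mod 3 = (k - i - (l - j)) mod 3"
    if "i \<ge> 0" "j \<ge> 0" "k \<ge> 0" "l \<ge> 0" for i j k l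
    using sector_types[OF A uw, of p i j k l] base that by (simp add: a)
  have "a i j \<in> carrier G" if "i \<ge> 0" "j \<ge> 0" for i j
    using sector_edge_oriented[OF A uw, of "i + 1" i j j p] that oriented_edge_closed
    by (auto simp: a unit_steps_def forward_steps_def)
  moreover have "i = k \<and> j = l" if "i \<ge> 0" "j \<ge> 0" "k \<ge> 0" "l \<ge> 0" "a i j = a k l" for i j k l
    using that lattice_point_inj[OF uw, of p i j k l] inj by (simp add: a inj_eq)
  moreover have "\<exists>i\<ge>0. \<exists>j\<ge>0. v = a i j" if "v \<in> \<Union>S" for v
  proof -
    from that obtain s x where "s \<in> cone p u w" "x \<in> s" "v = f x" unfolding S by blast
    then obtain i j where "i \<ge> 0" "j \<ge> 0" "v = f (?L i j)" unfolding cone_def by auto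
    then show ?thesis using a by metis
  qed
  moreover have "{a i j, a k l} \<in> S \<and> oriented_edge P T (a i j) (a k l) \<longleftrightarrow>
      (k - i, l - j) \<in> forward_steps" (is "?edge \<longleftrightarrow> ?step")
    if nn: "i \<ge> 0" "j \<ge> 0" "k \<ge> 0" "l \<ge> 0" for i j k l
  proof
    assume ?edge
    then obtain s where s: "s \<in> cone p u w" "f ` s = f ` {?L i j, ?L k l}"
      unfolding S by (auto simp: a nn)
    then have "s = {?L i j, ?L k l}" using inj by (metis inj_image_eq_iff)
    with s(1) have "{?L i j, ?L k l} \<in> coxeter_complex" by (simp add: cone_def)
    moreover have t: "(vertex_type (a k l) - vertex_type (a i j)) mod 3 = 1"
      using \<open>?edge\<close> oriented_edge_type(1) by blast
    then have "a i j \<noteq> a k l" by auto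
    then have "?L i j \<noteq> ?L k l" by (auto simp: a nn)
    ultimately have "(k - i, l - j) \<in> unit_steps"
      using lattice_point_edge_iff[OF uw] by blast
    moreover have "(k - i - (l - j)) mod 3 = 1"
      using t types nn by simp
    ultimately show ?step
      by (auto simp: unit_steps_def forward_steps_def)
  next
    assume ?step
    then have unit: "(k - i, l - j) \<in> unit_steps" and "(k - i - (l - j)) mod 3 = 1"
      by (auto simp: unit_steps_def forward_steps_def)
    then have "\<not> oriented_edge P T (a k l) (a i j)"
      using types[OF nn] oriented_edge_type(2)[of P T "a k l" "a i j"] by auto
    then have "oriented_edge P T (a i j) (a k l)"
      using sector_edge_oriented[OF A uw unit, of p] nn by (auto simp: a)
    moreover have "{?L i j, ?L k l} \<in> cone p u w"
      using lattice_point_edge_iff[OF uw, of p i j k l] unit nn by (auto simp: cone_def)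
    then have "{a i j, a k l} \<in> S"
      unfolding S by (rule rev_image_eqI) (simp add: a nn)
    ultimately show ?edge by simp
  qed
  ultimately show ?thesis unfolding oriented_coordinates_def by simp
qed

lemma oriented_coordinates_translate:
  assumes "oriented_coordinates S a" "h \<in> carrier G"
  shows "oriented_coordinates (translate_sector P T h S) (\<lambda>i j. h \<otimes>\<^bsub>G\<^esub> a i j)"
proof -
  note coords = oriented_coordinatesD[OF assms(1)]
  have S_carrier: "\<Union>S \<subseteq> carrier G" using coords(1,3) by blast
  have inj: "inj_on (\<lambda>v. h \<otimes>\<^bsub>G\<^esub> v) (carrier G)"
    using assms(2) by (rule G.inj_on_cmult)
  have "{h \<otimes>\<^bsub>G\<^esub> v, h \<otimes>\<^bsub>G\<^esub> w} \<in> translate_sector P T h S \<longleftrightarrow> {v, w} \<in> S"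
    if vw: "v \<in> carrier G" "w \<in> carrier G" for v w
  proof
    assume "{h \<otimes>\<^bsub>G\<^esub> v, h \<otimes>\<^bsub>G\<^esub> w} \<in> translate_sector P T h S"
    then obtain s where s: "s \<in> S" "(\<lambda>v. h \<otimes>\<^bsub>G\<^esub> v) ` s = (\<lambda>v. h \<otimes>\<^bsub>G\<^esub> v) ` {v, w}"
      unfolding translate_sector_def by auto
    then have "s = {v, w}"
      using inj_on_image_eq_iff[OF inj, of s "{v, w}"] S_carrier vw by blast
    with s show "{v, w} \<in> S" by simp
  next
    assume "{v, w} \<in> S"
    then show "{h \<otimes>\<^bsub>G\<^esub> v, h \<otimes>\<^bsub>G\<^esub> w} \<in> translate_sector P T h S"
      unfolding translate_sector_def by (rule rev_image_eqI) simp
  qed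
  moreover have "oriented_edge P T (h \<otimes>\<^bsub>G\<^esub> v) (h \<otimes>\<^bsub>G\<^esub> w) \<longleftrightarrow> oriented_edge P T v w"
    if "v \<in> carrier G" "w \<in> carrier G" for v w
    using oriented_edge_translate[of h v w]
      oriented_edge_translate[of "inv\<^bsub>G\<^esub> h" "h \<otimes>\<^bsub>G\<^esub> v" "h \<otimes>\<^bsub>G\<^esub> w"] that assms(2)
    by (auto simp: G.m_assoc[symmetric])
  moreover have "\<Union>(translate_sector P T h S) = (\<lambda>v. h \<otimes>\<^bsub>G\<^esub> v) ` \<Union>S"
    unfolding translate_sector_def by blast
  moreover have "\<exists>i\<ge>0. \<exists>j\<ge>0. v = h \<otimes>\<^bsub>G\<^esub> a i j" if "v \<in> (\<lambda>v. h \<otimes>\<^bsub>G\<^esub> v) ` \<Union>S" for v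
    using that coords(3) by blast
  moreover have "i = k \<and> j = l"
    if "h \<otimes>\<^bsub>G\<^esub> a i j = h \<otimes>\<^bsub>G\<^esub> a k l" "i \<ge> 0" "j \<ge> 0" "k \<ge> 0" "l \<ge> 0" for i j k l
    using that coords(1,2) assms(2) by simp
  ultimately show ?thesis
    using coords(1,4) assms(2) unfolding oriented_coordinates_def by simp
qed

text \<open>Rigidity: writing each vertex of \<open>R\<close> in the coordinates of \<open>S\<close> gives a map of the quadrant to
  which \<open>quadrant_map_is_translation\<close> applies. Orientation excludes that it exchanges the walls.\<close>

lemma subsector_coordinates:
  assumes "oriented_coordinates R b" "oriented_coordinates S a" "R \<subseteq> S"
  obtains m n where "m \<ge> 0" "n \<ge> 0"
    "\<And>i j. i \<ge> 0 \<Longrightarrow> j \<ge> 0 \<Longrightarrow> b i j = a (i + m) (j + n)"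
proof -
  note coords_b = oriented_coordinatesD[OF assms(1)] and coords_a = oriented_coordinatesD[OF assms(2)]
  have "\<exists>x. fst x \<ge> 0 \<and> snd x \<ge> 0 \<and> b i j = a (fst x) (snd x)" if "i \<ge> 0" "j \<ge> 0" for i j
  proof -
    have "{b i j, b (i + 1) j} \<in> R"
      using coords_b(4)[of i j "i + 1" j] that by (simp add: forward_steps_def)
    then have "b i j \<in> \<Union>S" using assms(3) by blast
    from coords_a(3)[OF this] obtain k l where "k \<ge> 0" "l \<ge> 0" "b i j = a k l" by blast
    then show ?thesis by (intro exI[of _ "(k, l)"]) simp
  qed
  then obtain \<psi> where
    \<psi>: "\<And>i j. i \<ge> 0 \<Longrightarrow> j \<ge> 0 \<Longrightarrow> fst (\<psi> i j) \<ge> 0 \<and> snd (\<psi> i j) \<ge> 0"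
    and b: "\<And>i j. i \<ge> 0 \<Longrightarrow> j \<ge> 0 \<Longrightarrow> b i j = a (fst (\<psi> i j)) (snd (\<psi> i j))"
    by metis
  have \<psi>_inj: "i = k \<and> j = l" if "i \<ge> 0" "j \<ge> 0" "k \<ge> 0" "l \<ge> 0" "\<psi> i j = \<psi> k l" for i j k l
    using that by (intro coords_b(2)) (simp_all add: b)
  have \<psi>_step: "\<psi> k l - \<psi> i j \<in> forward_steps"
    if "i \<ge> 0" "j \<ge> 0" "k \<ge> 0" "l \<ge> 0" "(k - i, l - j) \<in> forward_steps" for i j k l
  proof -
    have "{b i j, b k l} \<in> S" "oriented_edge P T (b i j) (b k l)"
      using coords_b(4)[of i j k l] that assms(3) by auto
    then have "(fst (\<psi> k l) - fst (\<psi> i j), snd (\<psi> k l) - snd (\<psi> i j)) \<in> forward_steps"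
      using coords_a(4)[of "fst (\<psi> i j)" "snd (\<psi> i j)" "fst (\<psi> k l)" "snd (\<psi> k l)"]
        \<psi>[of i j] \<psi>[of k l] b[of i j] b[of k l] that by simp
    then show ?thesis by (simp add: minus_prod_def)
  qed
  have shift: "\<psi> i j = \<psi> 0 0 + (i, j)" if "i \<ge> 0" "j \<ge> 0" for i j
    using \<psi> \<psi>_inj \<psi>_step that by (rule quadrant_map_is_translation)
  have "b i j = a (i + fst (\<psi> 0 0)) (j + snd (\<psi> 0 0))" if "i \<ge> 0" "j \<ge> 0" for i j
    unfolding b[OF that] shift[OF that] by (simp add: add.commute)
  then show thesis
    using \<psi>[of 0 0] by (intro that[of "fst (\<psi> 0 0)" "snd (\<psi> 0 0)"]) simp_all
qed


section \<open>Periodicity\<close>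

text \<open>The period is the difference of the positions of \<open>R\<close> in \<open>S\<close> and in \<open>g S\<close>. If
  it were zero, \<open>g\<close> would fix a vertex.\<close>

lemma common_subsector_periodic:
  assumes "S \<in> sectors P T" "R \<in> sectors P T" "R \<subseteq> S" "R \<subseteq> translate_sector P T g S"
    and g: "g \<in> carrier G" "g \<noteq> \<one>\<^bsub>G\<^esub>"
  shows "periodic_sector P T R"
proof -
  obtain a where a: "oriented_coordinates S a"
    using sector_has_labelling[OF assms(1)] labelling_oriented_coordinates by blast
  obtain b where b: "sector_labelling P T R b"
    using sector_has_labelling[OF assms(2)] by blast
  then have b': "oriented_coordinates R b" by (rule labelling_oriented_coordinates)
  obtain m n where "m \<ge> 0" "n \<ge> 0"
    and mn: "\<And>i j. i \<ge> 0 \<Longrightarrow> j \<ge> 0 \<Longrightarrow> b i j = a (i + m) (j + n)"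
    using subsector_coordinates[OF b' a assms(3)] by blast
  obtain m' n' where m'n'_nonneg: "m' \<ge> 0" "n' \<ge> 0"
    and m'n': "\<And>i j. i \<ge> 0 \<Longrightarrow> j \<ge> 0 \<Longrightarrow> b i j = g \<otimes>\<^bsub>G\<^esub> a (i + m') (j + n')"
    using subsector_coordinates[OF b' oriented_coordinates_translate[OF a g(1)] assms(4)] by blast
  define r s where "r = m' - m" and "s = n' - n"
  have carrier: "b i j \<in> carrier G" if "i \<ge> 0" "j \<ge> 0" for i j
    using oriented_coordinatesD(1)[OF b'] that .
  have shift: "b i j = g \<otimes>\<^bsub>G\<^esub> b (i + r) (j + s)"
    if "i \<ge> 0" "j \<ge> 0" "i + r \<ge> 0" "j + s \<ge> 0" for i j
    using mn[of "i + r" "j + s"] m'n'[of i j] that by (simp add: r_def s_def)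
  have "(r, s) \<noteq> (0, 0)"
  proof
    assume "(r, s) = (0, 0)"
    then have "b 0 0 = g \<otimes>\<^bsub>G\<^esub> b 0 0" using shift[of 0 0] by simp
    then show False using g carrier[of 0 0] by (metis G.r_cancel_one' order_refl)
  qed
  moreover have "periodic_labelling P T r s b"
    unfolding periodic_labelling_def
  proof (intro allI impI, elim conjE)
    fix i j k l :: int
    assume nn: "i \<ge> 0" "j \<ge> 0" "k \<ge> 0" "l \<ge> 0" "i + r \<ge> 0" "j + s \<ge> 0" "k + r \<ge> 0" "l + s \<ge> 0"
    let ?v = "b (i + r) (j + s)" and ?w = "b (k + r) (l + s)"
    have vw: "?v \<in> carrier G" "?w \<in> carrier G" using carrier nn by simp_all
    have "inv\<^bsub>G\<^esub> (b i j) \<otimes>\<^bsub>G\<^esub> b k l = inv\<^bsub>G\<^esub> (g \<otimes>\<^bsub>G\<^esub> ?v) \<otimes>\<^bsub>G\<^esub> (g \<otimes>\<^bsub>G\<^esub> ?w)"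
      using shift nn by metis
    also have "\<dots> = inv\<^bsub>G\<^esub> ?v \<otimes>\<^bsub>G\<^esub> (inv\<^bsub>G\<^esub> g \<otimes>\<^bsub>G\<^esub> (g \<otimes>\<^bsub>G\<^esub> ?w))"
      using vw g by (simp add: G.inv_mult_group G.m_assoc)
    also have "\<dots> = inv\<^bsub>G\<^esub> ?v \<otimes>\<^bsub>G\<^esub> ?w"
      using vw g by (simp add: G.m_assoc[symmetric])
    finally show "inv\<^bsub>G\<^esub> (b i j) \<otimes>\<^bsub>G\<^esub> b k l = inv\<^bsub>G\<^esub> ?v \<otimes>\<^bsub>G\<^esub> ?w" .
  qed
  ultimately show ?thesis unfolding periodic_sector_def using b by blast
qed

end

theorem proposition3p2:
  fixes q :: nat
    and P :: "'p set" and L :: "'l set" and inc :: "'p \<Rightarrow> 'l \<Rightarrow> bool"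
    and lam :: "'p \<Rightarrow> 'l" and T :: "('p \<times> 'p \<times> 'p) set"
  assumes "q \<ge> 2"
    and "finite_projective_plane q P L inc"
    and "bij_betw lam P L"
    and "triangle_presentation P inc lam T"
    and "\<omega> \<in> building_boundary P T"
    and "g \<in> carrier (triangle_group P T)"
    and "g \<noteq> \<one>\<^bsub>triangle_group P T\<^esub>"
    and "boundary_act P T g \<omega> = \<omega>"
  shows "\<omega> \<in> periodic_limit_points P T"
proof -
  have T: "T \<subseteq> P \<times> P \<times> P" using assms(4) unfolding triangle_presentation_def by (rule conjunct1)
  from assms(5)[unfolded building_boundary_def]
  obtain S where \<omega>: "\<omega> = sector_equiv P T `` {S}" and S: "S \<in> sectors P T"
    by (rule quotientE)
  have "S \<in> \<omega>" using S by (auto simp: \<omega> sector_equiv_def)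
  then have "translate_sector P T g S \<in> boundary_act P T g \<omega>"
    by (simp add: boundary_act_def)
  then have "translate_sector P T g S \<in> \<omega>"
    by (simp only: assms(8))
  then obtain R where R: "R \<in> sectors P T" "R \<subseteq> S" "R \<subseteq> translate_sector P T g S"
    by (auto simp: \<omega> sector_equiv_def)
  have "R \<in> \<omega>" using S R by (auto simp: \<omega> sector_equiv_def)
  moreover have "periodic_sector P T R"
    using common_subsector_periodic[OF T S R assms(6,7)] .
  ultimately show ?thesis
    using assms(5) by (auto simp: periodic_limit_points_def)
qed

end
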